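(* Let $X$ and $Y$ be classical (finite) sets. A quantum function $(H,P):X\to Y$ is exactly a family of projectors $\{P_{x,y}\}_{x\in X,y\in Y}$ on a Hilbert space $H$ such that for all $x\in X$ and $y_1,y_2\in Y$ $$P_{x,y_1}P_{x,y_2}=\delta_{y_1,y_2}P_{x,y_1},\qquad \sum_{y\in Y}P_{x,y}=\mathbb{1}_H.\qquad(1)$$ A quantum bijection $X\to Y$ is exactly a family of projectors $\{P_{x,y}\}_{x\in X,y\in Y}$ satisfying (1) and additionally, for all $x_1,x_2\in X$ and $y\in Y$, $$P_{x_1,y}P_{x_2,y}=\delta_{x_1,x_2}P_{x_1,y},\qquad \sum_{x\in X}P_{x,y}=\mathbb{1}_H.\qquad(2)$$ Here the correspondence between linear maps $P:H\otimes X\to Y\otimes H$ and families $\{P_{x,y}\}$ of operators on $H$ is $P(h\otimes|x\rangle)=\sum_{y\in Y}|y\rangle\otimes P_{x,y}h$.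
   Context: All Hilbert spaces are finite-dimensional and complex; coherence isomorphisms of $\otimes$ are suppressed. A projector on $H$ is an operator $p$ with $p=p^\dagger=p^2$. A classical set $X$ is identified with the special commutative dagger Frobenius algebra $\mathbb{C}^{X}$ with orthonormal basis $\{|x\rangle\}_{x\in X}$, $m_X(|x\rangle\otimes|x'\rangle)=\delta_{x,x'}|x\rangle$, $u_X(1)=\sum_x|x\rangle$, $\Delta_X=m_X^\dagger$, $\epsilon_X=u_X^\dagger$. A quantum function $(H,P):A\to B$ (for such algebras $A,B$) is a Hilbert space $H$ and a linear map $P:H\otimes A\to B\otimes H$ such that (i) $(\Delta_B\otimes\mathrm{id}_H)P=(\mathrm{id}_B\otimes P)(P\otimes \mathrm{id}_A)(\mathrm{id}_H\otimes\Delta_A)$; (ii) $(\epsilon_B\otimes\mathrm{id}_H)P=\mathrm{id}_H\otimes\epsilon_A$; (iii) $P^\dagger=(\epsilon_Bm_B\otimes\mathrm{id}_H\otimes\mathrm{id}_A)(\mathrm{id}_B\otimes P\otimes\mathrm{id}_A)(\mathrm{id}_B\otimes\mathrm{id}_H\otimes\Delta_Au_A)$. It is a quantum bijection if in addition $P(\mathrm{id}_H\otimes m_A)=(m_B\otimes\mathrm{id}_H)(\mathrm{id}_B\otimes P)(P\otimes\mathrm{id}_A)$ and $P(\mathrm{id}_H\otimes u_A)=u_B\otimes\mathrm{id}_H$. *)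

theory Defs
  imports Complex_Main "HOL-Library.FuncSet"
begin

section \<open>Finite-dimensional complex Hilbert spaces\<close>

class complex_vector = ab_group_add +
  fixes scaleC :: "complex \<Rightarrow> 'a \<Rightarrow> 'a"  (infixr \<open>*\<^sub>C\<close> 75)
  assumes scaleC_add_right: "c *\<^sub>C (x + y) = c *\<^sub>C x + c *\<^sub>C y"
    and scaleC_add_left: "(c + d) *\<^sub>C x = c *\<^sub>C x + d *\<^sub>C x"
    and scaleC_scaleC: "c *\<^sub>C d *\<^sub>C x = (c * d) *\<^sub>C x"
    and scaleC_one: "1 *\<^sub>C x = x"

global_interpretation cv: vector_space "scaleC :: complex \<Rightarrow> 'a \<Rightarrow> 'a::complex_vector"
  by unfold_locales
    (rule scaleC_add_right scaleC_add_left scaleC_scaleC scaleC_one)+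

global_interpretation cvp: vector_space_pair
  "scaleC :: complex \<Rightarrow> 'a \<Rightarrow> 'a::complex_vector"
  "scaleC :: complex \<Rightarrow> 'b \<Rightarrow> 'b::complex_vector"
  by unfold_locales

abbreviation clinear :: "('a::complex_vector \<Rightarrow> 'b::complex_vector) \<Rightarrow> bool"
  where "clinear \<equiv> Vector_Spaces.linear scaleC scaleC"

text \<open>The inner product is conjugate-linear in its first argument. Dimension zero is allowed;
  completeness is automatic in finite dimension.\<close>

class fd_hilbert = complex_vector +
  fixes cinner :: "'a \<Rightarrow> 'a \<Rightarrow> complex"
  assumes cinner_commute: "cinner x y = cnj (cinner y x)"
    and cinner_add_right: "cinner x (y + z) = cinner x y + cinner x z"
    and cinner_scaleC_right: "cinner x (c *\<^sub>C y) = c * cinner x y"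
    and cinner_pos: "x \<noteq> 0 \<Longrightarrow> 0 < Re (cinner x x)"
    and finite_spanning: "\<exists>B. finite B \<and> (\<forall>v. \<exists>c. v = (\<Sum>b\<in>B. c b *\<^sub>C b))"

definition onb :: "'i set \<Rightarrow> ('i \<Rightarrow> 'a::fd_hilbert) \<Rightarrow> bool"
  where "onb I e \<longleftrightarrow> finite I
    \<and> (\<forall>i\<in>I. \<forall>j\<in>I. cinner (e i) (e j) = (if i = j then 1 else 0))
    \<and> cv.span (e ` I) = UNIV"

definition dagger :: "('a::fd_hilbert \<Rightarrow> 'b::fd_hilbert) \<Rightarrow> 'b \<Rightarrow> 'a"
  where "dagger f = (THE g. \<forall>v w. cinner (f v) w = cinner v (g w))"

definition projector :: "('h::fd_hilbert \<Rightarrow> 'h) \<Rightarrow> bool"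
  where "projector p \<longleftrightarrow> clinear p \<and> dagger p = p \<and> p \<circ> p = p"

instantiation complex :: fd_hilbert
begin
definition scaleC_complex :: "complex \<Rightarrow> complex \<Rightarrow> complex"
  where "scaleC_complex = (*)"
definition cinner_complex :: "complex \<Rightarrow> complex \<Rightarrow> complex"
  where "cinner_complex z w = cnj z * w"
instance
proof
  show "\<exists>B. finite B \<and> (\<forall>v::complex. \<exists>c. v = (\<Sum>b\<in>B. c b *\<^sub>C b))"
    by (rule exI[of _ "{1}"]) (auto simp: scaleC_complex_def)
  fix x :: complex
  assume "x \<noteq> 0"
  then show "0 < Re (cinner x x)"
    by (simp add: cinner_complex_def complex_eq_iff sum_power2_gt_zero_iff flip: power2_eq_square)
qed (simp_all add: scaleC_complex_def cinner_complex_def algebra_simps)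
end

lemma finite_dimensional: "\<exists>B :: 'a::fd_hilbert set. finite B \<and> cv.span B = UNIV"
proof -
  obtain B :: "'a set" where B: "finite B" "\<forall>v. \<exists>c. v = (\<Sum>b\<in>B. c b *\<^sub>C b)"
    using finite_spanning by auto
  then have "cv.span B = UNIV" by (auto simp: cv.span_finite)
  then show ?thesis using B by blast
qed

lemma cinner_add_left: "cinner (x + y) z = cinner x z + cinner y z"
  by (metis cinner_add_right cinner_commute complex_cnj_add)

lemma cinner_scaleC_left: "cinner (c *\<^sub>C x) y = cnj c * cinner x y"
  by (metis cinner_commute cinner_scaleC_right complex_cnj_mult)

lemma cinner_zero_right [simp]: "cinner x 0 = 0"
  using cinner_add_right[of x 0 0] by simp

lemma cinner_zero_left [simp]: "cinner 0 x = 0"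
  using cinner_add_left[of 0 0 x] by simp

lemma cinner_diff_right: "cinner x (y - z) = cinner x y - cinner x z"
  using cinner_add_right[of x "y - z" z] by simp

lemma cinner_sum_right: "cinner x (sum f S) = (\<Sum>i\<in>S. cinner x (f i))"
  by (induction S rule: infinite_finite_induct) (simp_all add: cinner_add_right)

lemma cinner_sum_left: "cinner (sum f S) x = (\<Sum>i\<in>S. cinner (f i) x)"
  by (induction S rule: infinite_finite_induct) (simp_all add: cinner_add_left)

lemma cinner_self_real: "cinner x x = of_real (Re (cinner x x))"
  by (metis Reals_cnj_iff cinner_commute of_real_Re)

lemma cinner_eq_zero_iff [simp]: "cinner x x = 0 \<longleftrightarrow> x = 0"
  using cinner_pos[of x] by (cases "x = 0") auto

lemma cinner_ext: "(\<And>v. cinner v x = cinner v y) \<Longrightarrow> x = y"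
  by (metis cinner_diff_right cinner_eq_zero_iff diff_self eq_iff_diff_eq_0)

lemma clinearI:
  assumes "\<And>x y. f (x + y) = f x + f y" "\<And>c x. f (c *\<^sub>C x) = c *\<^sub>C f x"
  shows "clinear f"
  by (simp add: Vector_Spaces.linear_iff assms cv.vector_space_axioms)

lemma onb_expansion:
  assumes "onb I e"
  shows "v = (\<Sum>i\<in>I. cinner (e i) v *\<^sub>C e i)"
proof -
  have fin: "finite I" and on: "\<And>i j. i \<in> I \<Longrightarrow> j \<in> I \<Longrightarrow> cinner (e i) (e j) = (if i = j then 1 else 0)"
    and sp: "v \<in> cv.span (e ` I)"
    using assms by (auto simp: onb_def)
  show ?thesis
    using sp
  proof (induction rule: cv.span_induct_alt)
    case base
    show ?case by simp
  next
    case (step c x y)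
    then obtain j where j: "j \<in> I" "x = e j" by auto
    have "(\<Sum>i\<in>I. cinner (e i) x *\<^sub>C e i) = (\<Sum>i\<in>I. if i = j then e j else 0)"
      by (rule sum.cong) (auto simp: j on)
    also have "\<dots> = x" using j fin by simp
    finally have x: "(\<Sum>i\<in>I. cinner (e i) x *\<^sub>C e i) = x" .
    have "(\<Sum>i\<in>I. cinner (e i) (c *\<^sub>C x + y) *\<^sub>C e i)
        = c *\<^sub>C (\<Sum>i\<in>I. cinner (e i) x *\<^sub>C e i) + (\<Sum>i\<in>I. cinner (e i) y *\<^sub>C e i)"
      by (simp add: cinner_add_right cinner_scaleC_right scaleC_add_left
          cv.scale_sum_right sum.distrib)
    then show ?case using x step.IH by simp
  qed
qed

lemma gram_schmidt:
  assumes "finite (B :: 'a::fd_hilbert set)"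
  shows "\<exists>E. finite E \<and> (\<forall>x\<in>E. \<forall>y\<in>E. cinner x y = (if x = y then 1 else 0)) \<and> B \<subseteq> cv.span E"
  using assms
proof (induction B rule: finite_induct)
  case empty
  show ?case by (intro exI[of _ "{}"]) simp
next
  case (insert b B)
  then obtain E where fin: "finite E"
    and on: "\<And>x y. x \<in> E \<Longrightarrow> y \<in> E \<Longrightarrow> cinner x y = (if x = y then 1 else 0)"
    and sp: "B \<subseteq> cv.span E"
    by auto
  define p where "p = (\<Sum>x\<in>E. cinner x b *\<^sub>C x)"
  define w where "w = b - p"
  have pE: "p \<in> cv.span E"
    unfolding p_def by (intro cv.span_sum cv.span_scale cv.span_base)
  show ?case
  proof (cases "w = 0")
    case True
    then have "b \<in> cv.span E" using pE by (simp add: w_def)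
    then show ?thesis using fin on sp by (intro exI[of _ E]) auto
  next
    case False
    define r where "r = Re (cinner w w)"
    have r: "0 < r" "cinner w w = of_real r"
      using cinner_pos[OF False] cinner_self_real[of w] by (auto simp: r_def)
    define u where "u = of_real (inverse (sqrt r)) *\<^sub>C w"
    have w0: "cinner x w = 0" if "x \<in> E" for x
    proof -
      have "cinner x p = (\<Sum>y\<in>E. if y = x then cinner x b else 0)"
        unfolding p_def cinner_sum_right
        by (rule sum.cong) (auto simp: cinner_scaleC_right on that)
      then show ?thesis using that fin by (simp add: w_def cinner_diff_right)
    qed
    have u0: "cinner x u = 0" "cinner u x = 0" if "x \<in> E" for x
      using w0[OF that] cinner_commute[of w x] unfolding u_def
      by (simp_all add: cinner_scaleC_right cinner_scaleC_left)
    have "inverse (sqrt r) * (inverse (sqrt r) * r) = 1"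
      using r(1) by (simp add: field_simps)
    then have u1: "cinner u u = 1"
      unfolding u_def cinner_scaleC_right cinner_scaleC_left r(2)
      by (metis complex_cnj_complex_of_real of_real_1 of_real_mult)
    have "w = of_real (sqrt r) *\<^sub>C u"
      using r(1) by (simp add: u_def scaleC_scaleC scaleC_one flip: of_real_mult)
    then have b: "b = p + of_real (sqrt r) *\<^sub>C u" by (simp add: w_def algebra_simps)
    have mono: "cv.span E \<subseteq> cv.span (insert u E)" by (rule cv.span_mono) auto
    have "b \<in> cv.span (insert u E)"
      unfolding b by (intro cv.span_add cv.span_scale) (use pE mono in \<open>auto intro: cv.span_base\<close>)
    moreover have "u \<notin> E" using u0(1)[of u] u1 by auto
    ultimately show ?thesis
      using fin on sp mono u0 u1 by (intro exI[of _ "insert u E"]) auto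
  qed
qed

definition some_onb :: "'a::fd_hilbert set"
  where "some_onb = (SOME E. onb E id)"

lemma onb_some_onb: "onb (some_onb :: 'a::fd_hilbert set) id"
proof -
  obtain B :: "'a set" where B: "finite B" "cv.span B = UNIV"
    using finite_dimensional by auto
  obtain E where E: "finite E" "\<forall>x\<in>E. \<forall>y\<in>E. cinner x y = (if x = y then 1 else 0)"
      "B \<subseteq> cv.span E"
    using gram_schmidt[OF B(1)] by auto
  have "cv.span E = UNIV"
    using cv.span_minimal[OF E(3)] B(2) cv.subspace_span by auto
  then have "onb E id" using E by (simp add: onb_def)
  then show ?thesis unfolding some_onb_def by (rule someI)
qed

lemma finite_some_onb [simp]: "finite some_onb"
  using onb_some_onb by (auto simp: onb_def)

lemma some_onb_expansion: "(\<Sum>e\<in>some_onb. cinner e v *\<^sub>C e) = v"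
  using onb_expansion[OF onb_some_onb, of v] by simp

lemma cinner_dagger:
  assumes "clinear f"
  shows "cinner (f v) w = cinner v (dagger f w)"
proof -
  define g where "g w = (\<Sum>e\<in>some_onb. cinner (f e) w *\<^sub>C e)" for w
  have g: "cinner (f v) w = cinner v (g w)" for v w
  proof -
    have "f v = (\<Sum>e\<in>some_onb. cinner e v *\<^sub>C f e)"
      by (subst some_onb_expansion[of v, symmetric])
        (simp add: cvp.linear_sum[OF assms] cvp.linear_scale[OF assms])
    then show ?thesis
      by (simp add: g_def cinner_sum_left cinner_sum_right cinner_scaleC_left
          cinner_scaleC_right flip: cinner_commute) (simp add: mult.commute)
  qed
  have "dagger f = g"
    unfolding dagger_def
  proof (rule the_equality)
    fix h assume "\<forall>v w. cinner (f v) w = cinner v (h w)"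
    then show "h = g" using g by (metis cinner_ext ext)
  qed (use g in blast)
  then show ?thesis using g by simp
qed


section \<open>Tensor products\<close>

text \<open>The Hilbert tensor product is realised as the space of conjugate-linear maps from the
  second factor to the first, with the Hilbert-Schmidt inner product, where \<open>a \<otimes> b\<close> is
  the map \<open>u \<mapsto> \<langle>u, b\<rangle> a\<close>. It is characterised by the universal property
  and the inner product of simple tensors, both proved below; the inner product does not depend on \<open>some_onb\<close>.\<close>

definition antilinear :: "('b::complex_vector \<Rightarrow> 'a::complex_vector) \<Rightarrow> bool"
  where "antilinear T \<longleftrightarrow> (\<forall>x y. T (x + y) = T x + T y) \<and> (\<forall>c x. T (c *\<^sub>C x) = cnj c *\<^sub>C T x)"

typedef (overloaded) ('a, 'b) tensor (infixr \<open>\<otimes>\<close> 65) =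
  "{T :: 'b::fd_hilbert \<Rightarrow> 'a::fd_hilbert. antilinear T}"
  morphisms tensor_app Abs_tensor
  by (intro exI[of _ "\<lambda>_. 0"]) (simp add: antilinear_def)

setup_lifting type_definition_tensor

instantiation tensor :: (fd_hilbert, fd_hilbert) complex_vector
begin
lift_definition zero_tensor :: "'a \<otimes> 'b" is "\<lambda>_. 0"
  by (simp add: antilinear_def)
lift_definition plus_tensor :: "'a \<otimes> 'b \<Rightarrow> 'a \<otimes> 'b \<Rightarrow> 'a \<otimes> 'b" is "\<lambda>S T u. S u + T u"
  by (simp add: antilinear_def scaleC_add_right)
lift_definition uminus_tensor :: "'a \<otimes> 'b \<Rightarrow> 'a \<otimes> 'b" is "\<lambda>T u. - T u"
  by (simp add: antilinear_def)
lift_definition minus_tensor :: "'a \<otimes> 'b \<Rightarrow> 'a \<otimes> 'b \<Rightarrow> 'a \<otimes> 'b" is "\<lambda>S T u. S u - T u"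
  by (simp add: antilinear_def cv.scale_right_diff_distrib)
lift_definition scaleC_tensor :: "complex \<Rightarrow> 'a \<otimes> 'b \<Rightarrow> 'a \<otimes> 'b" is "\<lambda>c T u. c *\<^sub>C T u"
  by (simp add: antilinear_def scaleC_add_right scaleC_scaleC mult.commute)
instance
  by standard (transfer; simp add: fun_eq_iff algebra_simps scaleC_add_right scaleC_add_left
      scaleC_scaleC scaleC_one)+
end

lift_definition tens :: "'a::fd_hilbert \<Rightarrow> 'b::fd_hilbert \<Rightarrow> 'a \<otimes> 'b" (infixr \<open>\<otimes>\<close> 70)
  is "\<lambda>a b u. cinner u b *\<^sub>C a"
  by (simp add: antilinear_def cinner_add_left cinner_scaleC_left scaleC_add_left scaleC_scaleC)

lemma tens_add_left: "(a + a') \<otimes> b = a \<otimes> b + a' \<otimes> b"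
  by transfer (simp add: scaleC_add_right)

lemma tens_add_right: "a \<otimes> (b + b') = a \<otimes> b + a \<otimes> b'"
  by transfer (simp add: cinner_add_right scaleC_add_left)

lemma tens_scaleC_left: "(c *\<^sub>C a) \<otimes> b = c *\<^sub>C (a \<otimes> b)"
  by transfer (simp add: scaleC_scaleC mult.commute)

lemma tens_scaleC_right: "a \<otimes> (c *\<^sub>C b) = c *\<^sub>C (a \<otimes> b)"
  by transfer (simp add: scaleC_scaleC cinner_scaleC_right)

lemma tensor_app_add: "tensor_app T (x + y) = tensor_app T x + tensor_app T y"
  and tensor_app_scaleC: "tensor_app T (c *\<^sub>C x) = cnj c *\<^sub>C tensor_app T x"
  using tensor_app[of T] by (auto simp: antilinear_def)

lemma tensor_app_sum: "tensor_app T (sum f S) = (\<Sum>i\<in>S. tensor_app T (f i))"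
proof -
  have "tensor_app T 0 = 0" using tensor_app_add[of T 0 0] by simp
  then show ?thesis
    by (induction S rule: infinite_finite_induct) (simp_all add: tensor_app_add)
qed

lemma sum_tensor_app: "tensor_app (sum F S) u = (\<Sum>i\<in>S. tensor_app (F i) u)"
  by (induction S rule: infinite_finite_induct)
    (simp_all add: zero_tensor.rep_eq plus_tensor.rep_eq)

lemma tensor_expansion: "(\<Sum>f\<in>some_onb. tensor_app T f \<otimes> f) = T"
proof -
  have "tensor_app (\<Sum>f\<in>some_onb. tensor_app T f \<otimes> f) u = tensor_app T u" for u
  proof -
    have "tensor_app T u = tensor_app T (\<Sum>f\<in>some_onb. cinner f u *\<^sub>C f)"
      by (simp add: some_onb_expansion)
    also have "\<dots> = (\<Sum>f\<in>some_onb. cinner u f *\<^sub>C tensor_app T f)"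
      by (simp add: tensor_app_sum tensor_app_scaleC flip: cinner_commute)
    finally show ?thesis by (simp add: sum_tensor_app tens.rep_eq)
  qed
  then show ?thesis by (simp add: tensor_app_inject[symmetric] fun_eq_iff)
qed

instantiation tensor :: (fd_hilbert, fd_hilbert) fd_hilbert
begin
definition cinner_tensor :: "'a \<otimes> 'b \<Rightarrow> 'a \<otimes> 'b \<Rightarrow> complex"
  where "cinner_tensor S T = (\<Sum>e\<in>some_onb. cinner (tensor_app S e) (tensor_app T e))"
instance
proof
  fix S T U :: "'a \<otimes> 'b" and c :: complex
  show "cinner S T = cnj (cinner T S)"
    by (simp add: cinner_tensor_def flip: cinner_commute)
  show "cinner S (T + U) = cinner S T + cinner S U"
    by (simp add: cinner_tensor_def plus_tensor.rep_eq cinner_add_right sum.distrib)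
  show "cinner S (c *\<^sub>C T) = c * cinner S T"
    by (simp add: cinner_tensor_def scaleC_tensor.rep_eq cinner_scaleC_right sum_distrib_left)
  show "0 < Re (cinner T T)" if "T \<noteq> 0"
  proof -
    have nn: "0 \<le> Re (cinner x x)" for x :: 'a
      using cinner_pos[of x] by (cases "x = 0") auto
    have "\<exists>e\<in>some_onb. tensor_app T e \<noteq> 0"
    proof (rule ccontr)
      assume "\<not> ?thesis"
      moreover have "(0 :: 'a) \<otimes> f = 0" for f :: 'b
        using tens_add_left[of "0 :: 'a" 0 f] by simp
      ultimately show False using tensor_expansion[of T] that by simp
    qed
    then show ?thesis
      unfolding cinner_tensor_def Re_sum
      by (auto intro!: sum_pos2 cinner_pos nn)
  qed
  show "\<exists>B. finite B \<and> (\<forall>v :: 'a \<otimes> 'b. \<exists>c. v = (\<Sum>b\<in>B. c b *\<^sub>C b))"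
  proof -
    let ?B = "(\<lambda>(e, f). e \<otimes> f) ` ((some_onb :: 'a set) \<times> (some_onb :: 'b set))"
    have fin: "finite ?B" by simp
    have lin: "clinear (\<lambda>a :: 'a. a \<otimes> f)" for f :: 'b
      by (rule clinearI) (simp_all add: tens_add_left tens_scaleC_left)
    have "T \<in> cv.span ?B" for T
    proof -
      have "a \<otimes> f \<in> cv.span ?B" if "f \<in> some_onb" for a :: 'a and f :: 'b
      proof -
        have "a \<otimes> f = (\<Sum>e\<in>some_onb. cinner e a *\<^sub>C (e \<otimes> f))"
          by (subst some_onb_expansion[of a, symmetric])
            (simp add: cvp.linear_sum[OF lin] cvp.linear_scale[OF lin])
        also have "\<dots> \<in> cv.span ?B"
          using that by (intro cv.span_sum cv.span_scale cv.span_base) auto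
        finally show ?thesis .
      qed
      then show ?thesis
        by (subst tensor_expansion[of T, symmetric]) (intro cv.span_sum)
    qed
    then have "\<forall>v. \<exists>c. v = (\<Sum>b\<in>?B. c b *\<^sub>C b)"
      unfolding cv.span_finite[OF fin] by blast
    with fin show ?thesis by blast
  qed
qed
end

lemma cinner_tens: "cinner (a \<otimes> b) (a' \<otimes> b') = cinner a a' * cinner b b'"
proof -
  have "cinner b b' = (\<Sum>e\<in>some_onb. cinner b (cinner e b' *\<^sub>C e))"
    by (simp add: some_onb_expansion flip: cinner_sum_right)
  then show ?thesis
    by (simp add: cinner_tensor_def tens.rep_eq cinner_scaleC_left cinner_scaleC_right
        sum_distrib_left mult_ac flip: cinner_commute)
qed

definition bilin :: "('a::complex_vector \<Rightarrow> 'b::complex_vector \<Rightarrow> 'c::complex_vector) \<Rightarrow> bool"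
  where "bilin g \<longleftrightarrow> (\<forall>a. clinear (g a)) \<and> (\<forall>b. clinear (\<lambda>a. g a b))"

text \<open>The linear map induced by a bilinear map.\<close>

definition tlift ::
    "('a::fd_hilbert \<Rightarrow> 'b::fd_hilbert \<Rightarrow> 'c::complex_vector) \<Rightarrow> 'a \<otimes> 'b \<Rightarrow> 'c"
  where "tlift g = (THE L. clinear L \<and> (\<forall>a b. L (a \<otimes> b) = g a b))"

lemma tensor_linear_ext:
  assumes "clinear L" "clinear M" "\<And>a b. L (a \<otimes> b) = M (a \<otimes> b)"
  shows "L = M"
proof
  fix T
  show "L T = M T"
    by (subst (1 2) tensor_expansion[of T, symmetric])
      (simp add: cvp.linear_sum[OF assms(1)] cvp.linear_sum[OF assms(2)] assms(3))
qed

lemma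
  assumes "bilin g"
  shows clinear_tlift: "clinear (tlift g)"
    and tlift_tens [simp]: "tlift g (a \<otimes> b) = g a b"
proof -
  have l: "clinear (g a)" and r: "clinear (\<lambda>a. g a b)" for a b
    using assms by (auto simp: bilin_def)
  define L where "L T = (\<Sum>f\<in>some_onb. g (tensor_app T f) f)" for T
  have "clinear L"
    by (rule clinearI)
      (simp_all add: L_def plus_tensor.rep_eq scaleC_tensor.rep_eq cvp.linear_add[OF r]
        cvp.linear_scale[OF r] sum.distrib cv.scale_sum_right)
  moreover have "L (a \<otimes> b) = g a b" for a b
  proof -
    have "g a b = g a (\<Sum>f\<in>some_onb. cinner f b *\<^sub>C f)" by (simp add: some_onb_expansion)
    then show ?thesis
      by (simp add: L_def tens.rep_eq cvp.linear_scale[OF r] cvp.linear_sum[OF l]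
          cvp.linear_scale[OF l])
  qed
  ultimately have L: "clinear L" "\<And>a b. L (a \<otimes> b) = g a b" by blast+
  have "tlift g = L"
    unfolding tlift_def
  proof (rule the_equality)
    fix M assume "clinear M \<and> (\<forall>a b. M (a \<otimes> b) = g a b)"
    then show "M = L" by (intro tensor_linear_ext) (simp_all add: L)
  qed (use L in blast)
  then show "clinear (tlift g)" "tlift g (a \<otimes> b) = g a b" using L by simp_all
qed

definition tmap :: "('a::fd_hilbert \<Rightarrow> 'c::fd_hilbert) \<Rightarrow> ('b::fd_hilbert \<Rightarrow> 'd::fd_hilbert)
    \<Rightarrow> 'a \<otimes> 'b \<Rightarrow> 'c \<otimes> 'd"  (infixr \<open>\<otimes>\<^sub>l\<close> 70)
  where "f \<otimes>\<^sub>l g = tlift (\<lambda>a b. f a \<otimes> g b)"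

text \<open>Coherence isomorphisms; a prime marks the inverse.\<close>

definition assoc ::
    "('a::fd_hilbert \<otimes> 'b::fd_hilbert) \<otimes> 'c::fd_hilbert \<Rightarrow> 'a \<otimes> ('b \<otimes> 'c)"
  where "assoc = tlift (\<lambda>t c. tlift (\<lambda>a b. a \<otimes> (b \<otimes> c)) t)"

definition assoc' ::
    "'a::fd_hilbert \<otimes> ('b::fd_hilbert \<otimes> 'c::fd_hilbert) \<Rightarrow> ('a \<otimes> 'b) \<otimes> 'c"
  where "assoc' = tlift (\<lambda>a t. tlift (\<lambda>b c. (a \<otimes> b) \<otimes> c) t)"

definition lunit :: "complex \<otimes> 'a::fd_hilbert \<Rightarrow> 'a"
  where "lunit = tlift (\<lambda>z a. z *\<^sub>C a)"

definition lunit' :: "'a::fd_hilbert \<Rightarrow> complex \<otimes> 'a"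
  where "lunit' a = 1 \<otimes> a"

definition runit :: "'a::fd_hilbert \<otimes> complex \<Rightarrow> 'a"
  where "runit = tlift (\<lambda>a z. z *\<^sub>C a)"

definition runit' :: "'a::fd_hilbert \<Rightarrow> 'a \<otimes> complex"
  where "runit' a = a \<otimes> 1"

lemma tmap_tens:
  assumes "clinear f" "clinear g"
  shows "(f \<otimes>\<^sub>l g) (a \<otimes> b) = f a \<otimes> g b"
  unfolding tmap_def
  by (rule tlift_tens)
    (auto simp: bilin_def tens_add_left tens_add_right tens_scaleC_left tens_scaleC_right
      cvp.linear_add[OF assms(1)] cvp.linear_add[OF assms(2)]
      cvp.linear_scale[OF assms(1)] cvp.linear_scale[OF assms(2)] intro!: clinearI)

lemma assoc_tens:
  fixes a :: "'a::fd_hilbert" and b :: "'b::fd_hilbert" and c :: "'c::fd_hilbert"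
  shows "assoc ((a \<otimes> b) \<otimes> c) = a \<otimes> (b \<otimes> c)"
proof -
  have b: "bilin (\<lambda>a b. a \<otimes> (b \<otimes> c))" for c :: 'c
    by (auto simp: bilin_def tens_add_left tens_add_right tens_scaleC_left tens_scaleC_right
        intro!: clinearI)
  have ca: "tlift (\<lambda>a b. a \<otimes> (b \<otimes> (c + c')))
      = (\<lambda>t. tlift (\<lambda>a b. a \<otimes> (b \<otimes> c)) t + tlift (\<lambda>a b. a \<otimes> (b \<otimes> c')) t)"
    for c c' :: 'c
    by (rule tensor_linear_ext)
      (simp_all add: b clinear_tlift cvp.linear_compose_add
        cvp.linear_compose_scale_right, simp_all add: tens_add_right tens_scaleC_right)
  have cs: "tlift (\<lambda>a b. a \<otimes> (b \<otimes> (z *\<^sub>C c)))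
      = (\<lambda>t. z *\<^sub>C tlift (\<lambda>a b. a \<otimes> (b \<otimes> c)) t)"
    for z and c :: 'c
    by (rule tensor_linear_ext)
      (simp_all add: b clinear_tlift cvp.linear_compose_add
        cvp.linear_compose_scale_right, simp_all add: tens_add_right tens_scaleC_right)
  have "bilin (\<lambda>t c. tlift (\<lambda>a b. a \<otimes> (b \<otimes> c)) t :: 'a \<otimes> ('b \<otimes> 'c))"
    by (simp add: bilin_def clinear_tlift[OF b] clinearI fun_cong[OF ca] fun_cong[OF cs])
  then show ?thesis by (simp add: assoc_def b)
qed

lemma assoc'_tens:
  fixes a :: "'a::fd_hilbert" and b :: "'b::fd_hilbert" and c :: "'c::fd_hilbert"
  shows "assoc' (a \<otimes> (b \<otimes> c)) = (a \<otimes> b) \<otimes> c"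
proof -
  have b: "bilin (\<lambda>b c. (a \<otimes> b) \<otimes> c)" for a :: 'a
    by (auto simp: bilin_def tens_add_left tens_add_right tens_scaleC_left tens_scaleC_right
        intro!: clinearI)
  have ca: "tlift (\<lambda>b c. ((a + a') \<otimes> b) \<otimes> c)
      = (\<lambda>t. tlift (\<lambda>b c. (a \<otimes> b) \<otimes> c) t + tlift (\<lambda>b c. (a' \<otimes> b) \<otimes> c) t)"
    for a a' :: 'a
    by (rule tensor_linear_ext)
      (simp_all add: b clinear_tlift cvp.linear_compose_add
        cvp.linear_compose_scale_right, simp_all add: tens_add_left tens_scaleC_left)
  have cs: "tlift (\<lambda>b c. ((z *\<^sub>C a) \<otimes> b) \<otimes> c)
      = (\<lambda>t. z *\<^sub>C tlift (\<lambda>b c. (a \<otimes> b) \<otimes> c) t)"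
    for z and a :: 'a
    by (rule tensor_linear_ext)
      (simp_all add: b clinear_tlift cvp.linear_compose_add
        cvp.linear_compose_scale_right, simp_all add: tens_add_left tens_scaleC_left)
  have "bilin (\<lambda>a t. tlift (\<lambda>b c. (a \<otimes> b) \<otimes> c) t :: ('a \<otimes> 'b) \<otimes> 'c)"
    by (simp add: bilin_def clinear_tlift[OF b] clinearI fun_cong[OF ca] fun_cong[OF cs])
  then show ?thesis by (simp add: assoc'_def b)
qed

lemma lunit_tens: "lunit (z \<otimes> a) = z *\<^sub>C a"
  unfolding lunit_def
  by (rule tlift_tens) (auto simp: bilin_def scaleC_add_left scaleC_add_right scaleC_scaleC
      scaleC_complex_def mult.commute intro!: clinearI)

lemma runit_tens: "runit (a \<otimes> z) = z *\<^sub>C a"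
  unfolding runit_def
  by (rule tlift_tens) (auto simp: bilin_def scaleC_add_left scaleC_add_right scaleC_scaleC
      scaleC_complex_def mult.commute intro!: clinearI)


section \<open>Quantum functions and quantum bijections\<close>

text \<open>An algebra structure on \<open>'a\<close> is given by its multiplication \<open>'a \<otimes> 'a \<Rightarrow> 'a\<close> and unit
  \<open>complex \<Rightarrow> 'a\<close>; comultiplication and counit are their adjoints. The coherence isomorphisms
  are inserted explicitly.\<close>

definition quantum_function ::
    "('a::fd_hilbert \<otimes> 'a \<Rightarrow> 'a) \<Rightarrow> (complex \<Rightarrow> 'a) \<Rightarrow> ('b::fd_hilbert \<otimes> 'b \<Rightarrow> 'b) \<Rightarrow>
      (complex \<Rightarrow> 'b) \<Rightarrow> ('h::fd_hilbert \<otimes> 'a \<Rightarrow> 'b \<otimes> 'h) \<Rightarrow> bool"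
  where "quantum_function mA uA mB uB P \<longleftrightarrow> clinear P
    \<and> (dagger mB \<otimes>\<^sub>l id) \<circ> P
        = assoc' \<circ> (id \<otimes>\<^sub>l P) \<circ> assoc \<circ> (P \<otimes>\<^sub>l id) \<circ> assoc' \<circ> (id \<otimes>\<^sub>l dagger mA)
    \<and> lunit \<circ> (dagger uB \<otimes>\<^sub>l id) \<circ> P = runit \<circ> (id \<otimes>\<^sub>l dagger uA)
    \<and> dagger P
        = lunit \<circ> ((dagger uB \<circ> mB) \<otimes>\<^sub>l (id \<otimes>\<^sub>l id)) \<circ> assoc \<circ> (assoc' \<otimes>\<^sub>l id)
          \<circ> ((id \<otimes>\<^sub>l P) \<otimes>\<^sub>l id)
          \<circ> (assoc \<otimes>\<^sub>l id) \<circ> assoc' \<circ> ((id \<otimes>\<^sub>l id) \<otimes>\<^sub>l (dagger mA \<circ> uA)) \<circ> runit'"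

definition quantum_bijection ::
    "('a::fd_hilbert \<otimes> 'a \<Rightarrow> 'a) \<Rightarrow> (complex \<Rightarrow> 'a) \<Rightarrow> ('b::fd_hilbert \<otimes> 'b \<Rightarrow> 'b) \<Rightarrow>
      (complex \<Rightarrow> 'b) \<Rightarrow> ('h::fd_hilbert \<otimes> 'a \<Rightarrow> 'b \<otimes> 'h) \<Rightarrow> bool"
  where "quantum_bijection mA uA mB uB P \<longleftrightarrow> quantum_function mA uA mB uB P
    \<and> P \<circ> (id \<otimes>\<^sub>l mA)
        = (mB \<otimes>\<^sub>l id) \<circ> assoc' \<circ> (id \<otimes>\<^sub>l P) \<circ> assoc \<circ> (P \<otimes>\<^sub>l id) \<circ> assoc'
    \<and> P \<circ> (id \<otimes>\<^sub>l uA) \<circ> runit' = (uB \<otimes>\<^sub>l id) \<circ> lunit'"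

text \<open>The algebra of a finite set \<open>X\<close>, carried by any Hilbert space with an orthonormal basis
  \<open>ket\<close> indexed by \<open>X\<close> (so that \<open>X\<close> may be empty).\<close>

definition set_mult :: "'x set \<Rightarrow> ('x \<Rightarrow> 'a::fd_hilbert) \<Rightarrow> 'a \<otimes> 'a \<Rightarrow> 'a"
  where "set_mult X ket =
    tlift (\<lambda>a b. \<Sum>x\<in>X. (cinner (ket x) a * cinner (ket x) b) *\<^sub>C ket x)"

definition set_unit :: "'x set \<Rightarrow> ('x \<Rightarrow> 'a::fd_hilbert) \<Rightarrow> complex \<Rightarrow> 'a"
  where "set_unit X ket z = z *\<^sub>C (\<Sum>x\<in>X. ket x)"

lemma set_mult_ket:
  assumes "onb X ket" "x \<in> X" "x' \<in> X"
  shows "set_mult X ket (ket x \<otimes> ket x') = (if x = x' then ket x else 0)"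
proof -
  have b: "bilin (\<lambda>a b. \<Sum>x\<in>X. (cinner (ket x) a * cinner (ket x) b) *\<^sub>C ket x)"
    by (auto simp: bilin_def cinner_add_right cinner_scaleC_right algebra_simps scaleC_add_left
        scaleC_scaleC sum.distrib cv.scale_sum_right intro!: clinearI)
  have "(\<Sum>y\<in>X. (cinner (ket y) (ket x) * cinner (ket y) (ket x')) *\<^sub>C ket y)
      = (\<Sum>y\<in>X. if y = x then (if x = x' then ket x else 0) else 0)"
    using assms by (intro sum.cong) (auto simp: onb_def scaleC_one)
  then show ?thesis
    using assms by (simp add: set_mult_def b onb_def)
qed

definition op_families :: "'x set \<Rightarrow> 'y set \<Rightarrow> ('x \<Rightarrow> 'y \<Rightarrow> 'h::fd_hilbert \<Rightarrow> 'h) set"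
  where "op_families X Y = (X \<rightarrow>\<^sub>E Y \<rightarrow>\<^sub>E {T. clinear T})"

definition corresponds :: "'x set \<Rightarrow> ('x \<Rightarrow> 'a::fd_hilbert) \<Rightarrow> 'y set \<Rightarrow> ('y \<Rightarrow> 'b::fd_hilbert) \<Rightarrow>
    ('h::fd_hilbert \<otimes> 'a \<Rightarrow> 'b \<otimes> 'h) \<Rightarrow> ('x \<Rightarrow> 'y \<Rightarrow> 'h \<Rightarrow> 'h) \<Rightarrow> bool"
  where "corresponds X ketX Y ketY P p \<longleftrightarrow>
    (\<forall>h. \<forall>x\<in>X. P (h \<otimes> ketX x) = (\<Sum>y\<in>Y. ketY y \<otimes> p x y h))"

definition row_condition :: "'x set \<Rightarrow> 'y set \<Rightarrow> ('x \<Rightarrow> 'y \<Rightarrow> 'h::fd_hilbert \<Rightarrow> 'h) \<Rightarrow> bool"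
  where "row_condition X Y p \<longleftrightarrow>
    (\<forall>x\<in>X. \<forall>y1\<in>Y. \<forall>y2\<in>Y. p x y1 \<circ> p x y2 = (if y1 = y2 then p x y1 else (\<lambda>_. 0)))
    \<and> (\<forall>x\<in>X. (\<lambda>h. \<Sum>y\<in>Y. p x y h) = id)"

definition column_condition :: "'x set \<Rightarrow> 'y set \<Rightarrow> ('x \<Rightarrow> 'y \<Rightarrow> 'h::fd_hilbert \<Rightarrow> 'h) \<Rightarrow> bool"
  where "column_condition X Y p \<longleftrightarrow>
    (\<forall>x1\<in>X. \<forall>x2\<in>X. \<forall>y\<in>Y. p x1 y \<circ> p x2 y = (if x1 = x2 then p x1 y else (\<lambda>_. 0)))
    \<and> (\<forall>y\<in>Y. (\<lambda>h. \<Sum>x\<in>X. p x y h) = id)"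

end

theory Submission
  imports Defs
begin

text \<open>Every axiom is an equation between linear maps, so it may be tested on tensors with basis
  vectors. There both sides become sums \<open>\<Sum>\<^sub>y |y\<rangle> \<otimes> u\<^sub>y\<close>, \<open>\<Sum>\<^sub>y\<^sub>,\<^sub>z |y\<rangle> \<otimes> |z\<rangle> \<otimes> u\<^sub>y\<^sub>z\<close> or
  \<open>\<Sum>\<^sub>x u\<^sub>x \<otimes> |x\<rangle>\<close>, whose coefficients can be compared. Since
  \<open>\<Delta>|x\<rangle> = |x\<rangle> \<otimes> |x\<rangle>\<close> and \<open>\<epsilon>|x\<rangle> = 1\<close>, compatibility with comultiplication is row orthogonality
  together with idempotence, compatibility with the counit says that rows sum to the identity, and the
  axiom on \<open>P\<^sup>\<dagger>\<close> is self-adjointness of the entries; multiplication and unit give the column conditions.\<close>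

section \<open>Linearity of the structural maps\<close>

lemma clinear_tmap:
  assumes "clinear f" "clinear g"
  shows "clinear (f \<otimes>\<^sub>l g)"
  unfolding tmap_def
  by (rule clinear_tlift)
    (auto simp: bilin_def tens_add_left tens_add_right tens_scaleC_left tens_scaleC_right
      cvp.linear_add[OF assms(1)] cvp.linear_add[OF assms(2)]
      cvp.linear_scale[OF assms(1)] cvp.linear_scale[OF assms(2)] intro!: clinearI)

lemma clinear_tens_left: "clinear (\<lambda>a. a \<otimes> b)"
  by (rule clinearI) (simp_all add: tens_add_left tens_scaleC_left)

lemma clinear_tens_right: "clinear (\<lambda>b. a \<otimes> b)"
  by (rule clinearI) (simp_all add: tens_add_right tens_scaleC_right)

lemmas tens_sum_left = cvp.linear_sum[OF clinear_tens_left]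
lemmas tens_sum_right = cvp.linear_sum[OF clinear_tens_right]
lemmas tens_zero_left [simp] = cvp.linear_0[OF clinear_tens_left]
lemmas tens_zero_right [simp] = cvp.linear_0[OF clinear_tens_right]

lemma clinear_comp:
  assumes "clinear f" "clinear g"
  shows "clinear (f \<circ> g)"
  by (rule clinearI)
    (simp_all add: cvp.linear_add[OF assms(1)] cvp.linear_add[OF assms(2)]
      cvp.linear_scale[OF assms(1)] cvp.linear_scale[OF assms(2)])

lemma clinear_id: "clinear id"
  by (rule clinearI) simp_all

lemma clinear_cinner: "clinear (cinner a)"
  by (rule clinearI) (simp_all add: cinner_add_right cinner_scaleC_right scaleC_complex_def)

lemma cinner_dagger_left:
  assumes "clinear f"
  shows "cinner (dagger f w) v = cinner w (f v)"
  by (metis assms cinner_commute cinner_dagger)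

text \<open>Vectors can thus be compared as linear functionals, and functionals can be tested on
  simple tensors with basis vectors. The adjoints of the multiplication and of \<open>P\<close> are
  computed this way.\<close>

lemma cinner_inject: "cinner x = cinner y \<longleftrightarrow> x = y"
  by (metis cinner_commute cinner_ext)

text \<open>A linear map on the tensor product is determined by its values on simple tensors, so
  \<open>tlift\<close> inherits linearity in a parameter from the bilinear map it lifts. This makes
  the iterated lifts in the associators linear.\<close>

lemma bilin_tlift:
  fixes g :: "'a::fd_hilbert \<Rightarrow> 'b::fd_hilbert \<Rightarrow> 'c::complex_vector \<Rightarrow> 'd::complex_vector"
  assumes ab: "\<And>c. bilin (\<lambda>a b. g a b c)" and c: "\<And>a b. clinear (g a b)"
  shows "bilin (\<lambda>t c. tlift (\<lambda>a b. g a b c) t)"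
proof -
  have add: "tlift (\<lambda>a b. g a b (u + v))
      = (\<lambda>t. tlift (\<lambda>a b. g a b u) t + tlift (\<lambda>a b. g a b v) t)" for u v
    by (rule tensor_linear_ext)
      (simp_all add: ab clinear_tlift cvp.linear_compose_add, simp_all add: cvp.linear_add[OF c])
  have scale: "tlift (\<lambda>a b. g a b (z *\<^sub>C u)) = (\<lambda>t. z *\<^sub>C tlift (\<lambda>a b. g a b u) t)" for z u
    by (rule tensor_linear_ext)
      (simp_all add: ab clinear_tlift cvp.linear_compose_scale_right,
        simp_all add: cvp.linear_scale[OF c])
  show ?thesis
    by (simp add: bilin_def clinear_tlift[OF ab] clinearI fun_cong[OF add] fun_cong[OF scale])
qed

lemma bilin_swap: "bilin (\<lambda>a b. g b a) \<longleftrightarrow> bilin g"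
  by (auto simp: bilin_def)

lemma clinear_assoc: "clinear assoc"
  unfolding assoc_def
  by (intro clinear_tlift bilin_tlift)
    (auto simp: bilin_def tens_add_left tens_add_right tens_scaleC_left tens_scaleC_right
      intro!: clinearI)

lemma clinear_assoc': "clinear assoc'"
  unfolding assoc'_def
  \<comment> \<open>In \<open>assoc'\<close> the inner lift runs over the second argument, so the
    arguments are exchanged to fit \<open>bilin_tlift\<close>.\<close>
  by (intro clinear_tlift, subst bilin_swap[symmetric], intro bilin_tlift)
    (auto simp: bilin_def tens_add_left tens_add_right tens_scaleC_left tens_scaleC_right
      intro!: clinearI)

lemma clinear_lunit: "clinear lunit"
  unfolding lunit_def
  by (rule clinear_tlift) (auto simp: bilin_def scaleC_add_left scaleC_add_right scaleC_scaleC
      scaleC_complex_def mult.commute intro!: clinearI)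

lemma clinear_runit: "clinear runit"
  unfolding runit_def
  by (rule clinear_tlift) (auto simp: bilin_def scaleC_add_left scaleC_add_right scaleC_scaleC
      scaleC_complex_def mult.commute intro!: clinearI)

lemma clinear_lunit': "clinear lunit'"
  unfolding lunit'_def[abs_def] by (rule clinear_tens_right)

lemma clinear_runit': "clinear runit'"
  unfolding runit'_def[abs_def] by (rule clinear_tens_left)

text \<open>\<open>cinner v (dagger f w)\<close> equals \<open>cinner (f v) w\<close>, which is
  linear in \<open>w\<close>, and inner products against all \<open>v\<close> separate
  vectors.\<close>

lemma clinear_dagger:
  assumes "clinear f"
  shows "clinear (dagger f)"
  by (rule clinearI; rule cinner_ext)
    (simp_all add: cinner_add_right cinner_scaleC_right flip: cinner_dagger[OF assms])

lemma clinear_set_mult: "clinear (set_mult X ket)"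
  unfolding set_mult_def
  by (rule clinear_tlift)
    (auto simp: bilin_def cinner_add_right cinner_scaleC_right algebra_simps scaleC_add_left
        scaleC_scaleC sum.distrib cv.scale_sum_right intro!: clinearI)

lemma set_mult_tens:
  "set_mult X ket (a \<otimes> b) = (\<Sum>x\<in>X. (cinner (ket x) a * cinner (ket x) b) *\<^sub>C ket x)"
  unfolding set_mult_def
  by (rule tlift_tens)
    (auto simp: bilin_def cinner_add_right cinner_scaleC_right algebra_simps scaleC_add_left
        scaleC_scaleC sum.distrib cv.scale_sum_right intro!: clinearI)

lemma clinear_set_unit: "clinear (set_unit X ket)"
  unfolding set_unit_def
  by (rule clinearI) (simp_all add: scaleC_add_left scaleC_scaleC scaleC_complex_def)

lemmas clinear_intros = clinear_tmap clinear_comp clinear_id clinear_assoc clinear_assoc'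
  clinear_lunit clinear_runit clinear_lunit' clinear_runit' clinear_dagger clinear_set_mult
  clinear_set_unit

lemmas assoc_sum = cvp.linear_sum[OF clinear_assoc]
lemmas assoc'_sum = cvp.linear_sum[OF clinear_assoc']
lemmas lunit_sum = cvp.linear_sum[OF clinear_lunit]
lemmas runit_sum = cvp.linear_sum[OF clinear_runit]
lemmas tmap_sum = cvp.linear_sum[OF clinear_tmap]


section \<open>Tensors over an orthonormal basis\<close>

lemma onb_linear_ext:
  assumes "onb I e" "clinear L" "clinear M" "\<And>i. i \<in> I \<Longrightarrow> L (e i) = M (e i)"
  shows "L = M"
proof
  fix v
  show "L v = M v"
    by (subst (1 2) onb_expansion[OF assms(1), of v])
      (simp add: assms(4) cvp.linear_sum[OF assms(2)] cvp.linear_sum[OF assms(3)]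
        cvp.linear_scale[OF assms(2)] cvp.linear_scale[OF assms(3)])
qed

lemma tens_onb_ext_right:
  assumes e: "onb I e" and L: "clinear L" and M: "clinear M"
    and eq: "\<And>h i. i \<in> I \<Longrightarrow> L (h \<otimes> e i) = M (h \<otimes> e i)"
  shows "L = M"
proof (rule tensor_linear_ext[OF L M])
  fix h a
  have "L \<circ> (\<lambda>b. h \<otimes> b) = M \<circ> (\<lambda>b. h \<otimes> b)"
    by (rule onb_linear_ext[OF e]) (simp_all add: clinear_comp clinear_tens_right L M eq)
  then show "L (h \<otimes> a) = M (h \<otimes> a)" by (simp add: fun_eq_iff)
qed

lemma tens_onb_ext_left:
  assumes e: "onb I e" and L: "clinear L" and M: "clinear M"
    and eq: "\<And>h i. i \<in> I \<Longrightarrow> L (e i \<otimes> h) = M (e i \<otimes> h)"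
  shows "L = M"
proof (rule tensor_linear_ext[OF L M])
  fix h a
  have "L \<circ> (\<lambda>b. b \<otimes> h) = M \<circ> (\<lambda>b. b \<otimes> h)"
    by (rule onb_linear_ext[OF e]) (simp_all add: clinear_comp clinear_tens_left L M eq)
  then show "L (a \<otimes> h) = M (a \<otimes> h)" by (simp add: fun_eq_iff)
qed

lemma tens_onb_ext_right2:
  assumes e: "onb I e" and L: "clinear L" and M: "clinear M"
    and eq: "\<And>h i j. i \<in> I \<Longrightarrow> j \<in> I \<Longrightarrow> L (h \<otimes> (e i \<otimes> e j)) = M (h \<otimes> (e i \<otimes> e j))"
  shows "L = M"
proof (rule tensor_linear_ext[OF L M])
  fix h t
  \<comment> \<open>The extension is done twice: with \<open>h\<close> and \<open>e j\<close> fixed,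
    over the first factor of \<open>t\<close>; then over its second factor.\<close>
  have "(L \<circ> (\<lambda>t. h \<otimes> t)) \<circ> (\<lambda>a. a \<otimes> e j) = (M \<circ> (\<lambda>t. h \<otimes> t)) \<circ> (\<lambda>a. a \<otimes> e j)"
    if "j \<in> I" for j
    by (rule onb_linear_ext[OF e])
      (simp_all add: clinear_comp clinear_tens_right clinear_tens_left L M eq that)
  then have "L \<circ> (\<lambda>t. h \<otimes> t) = M \<circ> (\<lambda>t. h \<otimes> t)"
    by (intro tens_onb_ext_right[OF e])
      (simp_all add: clinear_comp clinear_tens_right L M fun_eq_iff)
  then show "L (h \<otimes> t) = M (h \<otimes> t)" by (simp add: fun_eq_iff)
qed

lemma tens_onb_eq_iff_right:
  assumes "onb I e" "clinear L" "clinear M"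
  shows "L = M \<longleftrightarrow> (\<forall>i\<in>I. \<forall>h. L (h \<otimes> e i) = M (h \<otimes> e i))"
  by (intro iffI tens_onb_ext_right[OF assms]) auto

lemma tens_onb_eq_iff_left:
  assumes "onb I e" "clinear L" "clinear M"
  shows "L = M \<longleftrightarrow> (\<forall>i\<in>I. \<forall>h. L (e i \<otimes> h) = M (e i \<otimes> h))"
  by (intro iffI tens_onb_ext_left[OF assms]) auto

lemma tens_onb_eq_iff_right2:
  assumes "onb I e" "clinear L" "clinear M"
  shows "L = M \<longleftrightarrow> (\<forall>i\<in>I. \<forall>j\<in>I. \<forall>h. L (h \<otimes> (e i \<otimes> e j)) = M (h \<otimes> (e i \<otimes> e j)))"
  by (intro iffI tens_onb_ext_right2[OF assms]) auto

text \<open>Partial inner product with \<open>b\<close> in the first factor. For \<open>b\<close> in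
  an orthonormal basis it reads off the coefficients \<open>u i\<close> of
  \<open>\<Sum>i\<in>I. e i \<otimes> u i\<close>.\<close>

definition slice :: "'b::fd_hilbert \<Rightarrow> 'b \<otimes> 'h::fd_hilbert \<Rightarrow> 'h"
  where "slice b = lunit \<circ> (cinner b \<otimes>\<^sub>l id)"

lemma clinear_slice: "clinear (slice b)"
  unfolding slice_def by (intro clinear_intros clinear_cinner)

lemma slice_tens: "slice b (a \<otimes> h) = cinner b a *\<^sub>C h"
  by (simp add: slice_def tmap_tens clinear_cinner clinear_id lunit_tens)

lemma slice_sum:
  assumes "onb I e" "i \<in> I"
  shows "slice (e i) (\<Sum>j\<in>I. e j \<otimes> u j) = u i"
proof -
  have "slice (e i) (\<Sum>j\<in>I. e j \<otimes> u j) = (\<Sum>j\<in>I. if j = i then u i else 0)"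
    unfolding cvp.linear_sum[OF clinear_slice]
    by (rule sum.cong) (use assms in \<open>auto simp: slice_tens onb_def scaleC_one\<close>)
  then show ?thesis using assms by (simp add: onb_def)
qed

text \<open>This is the resolution of the identity by an orthonormal basis, tensored with the
  identity; by linearity it suffices to check it on \<open>e i \<otimes> h\<close>.\<close>

lemma slice_expansion:
  fixes T :: "'b::fd_hilbert \<otimes> 'h::fd_hilbert"
  assumes "onb I e"
  shows "(\<Sum>i\<in>I. e i \<otimes> slice (e i) T) = T"
proof -
  have "(\<lambda>T :: 'b \<otimes> 'h. \<Sum>i\<in>I. e i \<otimes> slice (e i) T) = id"
  proof (rule tens_onb_ext_left[OF assms])
    show "clinear (\<lambda>T :: 'b \<otimes> 'h. \<Sum>i\<in>I. e i \<otimes> slice (e i) T)"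
      by (rule clinearI)
        (simp_all add: cvp.linear_add[OF clinear_slice] cvp.linear_scale[OF clinear_slice]
          tens_add_right tens_scaleC_right sum.distrib cv.scale_sum_right)
    fix h :: 'h and i
    assume "i \<in> I"
    then have "(\<Sum>j\<in>I. e j \<otimes> slice (e j) (e i \<otimes> h)) = (\<Sum>j\<in>I. if j = i then e i \<otimes> h else 0)"
      by (intro sum.cong) (use assms in \<open>auto simp: slice_tens onb_def scaleC_one\<close>)
    then show "(\<Sum>j\<in>I. e j \<otimes> slice (e j) (e i \<otimes> h)) = id (e i \<otimes> h)"
      using assms \<open>i \<in> I\<close> by (simp add: onb_def)
  qed (rule clinear_id)
  then show ?thesis by (simp add: fun_eq_iff)
qed

lemma sum_tens_eq_iff:
  assumes "onb I e"
  shows "(\<Sum>i\<in>I. e i \<otimes> u i) = (\<Sum>i\<in>I. e i \<otimes> v i) \<longleftrightarrow> (\<forall>i\<in>I. u i = v i)"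
  by (metis (no_types, lifting) assms slice_sum sum.cong)

lemma sum_tens_eq_iff2:
  assumes "onb I e"
  shows "(\<Sum>i\<in>I. \<Sum>j\<in>I. (e i \<otimes> e j) \<otimes> u i j) = (\<Sum>i\<in>I. \<Sum>j\<in>I. (e i \<otimes> e j) \<otimes> v i j)
    \<longleftrightarrow> (\<forall>i\<in>I. \<forall>j\<in>I. u i j = v i j)" (is "?l = ?r \<longleftrightarrow> ?eq")
proof
  assume "?l = ?r"
  \<comment> \<open>Reassociating turns the double sum into nested single sums, to which
    \<open>sum_tens_eq_iff\<close> applies twice.\<close>
  then have "assoc ?l = assoc ?r" by simp
  then have "(\<Sum>i\<in>I. e i \<otimes> (\<Sum>j\<in>I. e j \<otimes> u i j)) = (\<Sum>i\<in>I. e i \<otimes> (\<Sum>j\<in>I. e j \<otimes> v i j))"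
    by (simp add: assoc_sum assoc_tens tens_sum_right)
  then show ?eq by (simp add: sum_tens_eq_iff[OF assms])
qed simp

lemma sum_tens_right_eq_iff:
  assumes e: "onb I e"
  shows "(\<Sum>i\<in>I. u i \<otimes> e i) = (\<Sum>i\<in>I. v i \<otimes> e i) \<longleftrightarrow> (\<forall>i\<in>I. u i = v i)"
proof -
  \<comment> \<open>A tensor is represented by an antilinear map from the second factor to the
    first, so evaluation at \<open>e j\<close> gives the coefficient of \<open>e j\<close>.\<close>
  have app: "tensor_app (\<Sum>i\<in>I. w i \<otimes> e i) (e j) = w j" if "j \<in> I" for w :: "_ \<Rightarrow> 'c::fd_hilbert" and j
  proof -
    have "tensor_app (\<Sum>i\<in>I. w i \<otimes> e i) (e j) = (\<Sum>i\<in>I. if i = j then w j else 0)"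
      unfolding sum_tensor_app
      by (rule sum.cong) (use e that in \<open>auto simp: tens.rep_eq onb_def scaleC_one\<close>)
    then show ?thesis using e that by (simp add: onb_def)
  qed
  show ?thesis by (metis (no_types, lifting) app sum.cong)
qed


text \<open>Padding a diagonal sum with zeros brings it into the shape in which
  \<open>sum_tens_eq_iff2\<close> compares coefficients.\<close>

lemma sum_tens_diag:
  assumes "finite I"
  shows "(\<Sum>i\<in>I. \<Sum>j\<in>I. (e i \<otimes> e j) \<otimes> (if i = j then u i else 0)) = (\<Sum>i\<in>I. (e i \<otimes> e i) \<otimes> u i)"
proof (rule sum.cong)
  fix i
  assume "i \<in> I"
  have "(\<Sum>j\<in>I. (e i \<otimes> e j) \<otimes> (if i = j then u i else 0))
      = (\<Sum>j\<in>I. if i = j then (e i \<otimes> e i) \<otimes> u i else 0)"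
    by (rule sum.cong) auto
  then show "(\<Sum>j\<in>I. (e i \<otimes> e j) \<otimes> (if i = j then u i else 0)) = (e i \<otimes> e i) \<otimes> u i"
    using \<open>i \<in> I\<close> assms by simp
qed simp


section \<open>The algebra of a finite set\<close>

text \<open>By orthonormality, pairing \<open>ket x\<close> with the product of \<open>a\<close> and
  \<open>b\<close> leaves \<open>cinner (ket x) a * cinner (ket x) b\<close>, which is also the
  pairing of \<open>ket x \<otimes> ket x\<close> with \<open>a \<otimes> b\<close>.\<close>

lemma dagger_set_mult_ket:
  assumes e: "onb X ket" and x: "x \<in> X"
  shows "dagger (set_mult X ket) (ket x) = ket x \<otimes> ket x"
proof -
  have "cinner (dagger (set_mult X ket) (ket x)) = cinner (ket x \<otimes> ket x)"
  proof (rule tensor_linear_ext[OF clinear_cinner clinear_cinner])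
    fix a b
    have "cinner (dagger (set_mult X ket) (ket x)) (a \<otimes> b)
        = cinner (ket x) (set_mult X ket (a \<otimes> b))"
      by (rule cinner_dagger_left[OF clinear_set_mult])
    also have "\<dots> = (\<Sum>y\<in>X. if y = x then cinner (ket x) a * cinner (ket x) b else 0)"
      unfolding set_mult_tens cinner_sum_right
      by (rule sum.cong) (use e x in \<open>auto simp: cinner_scaleC_right onb_def\<close>)
    finally show "cinner (dagger (set_mult X ket) (ket x)) (a \<otimes> b) = cinner (ket x \<otimes> ket x) (a \<otimes> b)"
      using e x by (simp add: cinner_tens onb_def)
  qed
  then show ?thesis by (simp only: cinner_inject)
qed

lemma dagger_set_unit_ket:
  assumes e: "onb X ket" and x: "x \<in> X"
  shows "dagger (set_unit X ket) (ket x) = 1"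
proof -
  \<comment> \<open>Writing a complex number \<open>z\<close> as \<open>cinner 1 z\<close> lets the
    adjoint be moved to the other side.\<close>
  have "dagger (set_unit X ket) (ket x) = cinner 1 (dagger (set_unit X ket) (ket x))"
    by (simp add: cinner_complex_def)
  also have "\<dots> = (\<Sum>y\<in>X. cinner (ket y) (ket x))"
    by (simp add: set_unit_def scaleC_one cinner_sum_left flip: cinner_dagger[OF clinear_set_unit])
  also have "\<dots> = (\<Sum>y\<in>X. if y = x then 1 else 0)"
    by (rule sum.cong) (use e x in \<open>auto simp: onb_def\<close>)
  finally show ?thesis using e x by (simp add: onb_def)
qed

lemma set_unit_one: "set_unit X ket 1 = (\<Sum>x\<in>X. ket x)"
  by (simp add: set_unit_def scaleC_one)


section \<open>Operator families\<close>

lemma correspondsD: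
  "corresponds X ketX Y ketY P p \<Longrightarrow> x \<in> X \<Longrightarrow> P (h \<otimes> ketX x) = (\<Sum>y\<in>Y. ketY y \<otimes> p x y h)"
  by (simp add: corresponds_def)

lemma ex1_family:
  fixes P :: "'h::fd_hilbert \<otimes> 'a::fd_hilbert \<Rightarrow> 'b::fd_hilbert \<otimes> 'h"
  assumes Y: "onb Y ketY" and P: "clinear P"
  shows "\<exists>!p. p \<in> op_families X Y \<and> corresponds X ketX Y ketY P p"
proof (rule ex1I)
  \<comment> \<open>The block matrix entries of \<open>P\<close>. Restriction to \<open>X\<close>
    and \<open>Y\<close> makes the family extensional; without it the values elsewhere would be
    arbitrary and uniqueness would fail.\<close>
  define p where "p = (\<lambda>x\<in>X. \<lambda>y\<in>Y. \<lambda>h. slice (ketY y) (P (h \<otimes> ketX x)))"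
  have "clinear (\<lambda>h. slice (ketY y) (P (h \<otimes> ketX x)))" for x y
    using clinear_comp[OF clinear_slice clinear_comp[OF P clinear_tens_left]] by (simp add: comp_def)
  then show "p \<in> op_families X Y \<and> corresponds X ketX Y ketY P p"
    by (auto simp: op_families_def corresponds_def p_def slice_expansion[OF Y])
  fix q
  assume q: "q \<in> op_families X Y \<and> corresponds X ketX Y ketY P q"
  have "q x y h = p x y h" if "x \<in> X" "y \<in> Y" for x y h
    using that q by (simp add: p_def correspondsD[of X ketX Y ketY P q] slice_sum[OF Y])
  then show "q = p"
    using q unfolding op_families_def p_def
    by (intro ext) (auto simp: PiE_iff extensional_def restrict_def fun_eq_iff)
qed

lemma ex1_map:
  fixes p :: "'x \<Rightarrow> 'y \<Rightarrow> 'h::fd_hilbert \<Rightarrow> 'h"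
    and ketX :: "'x \<Rightarrow> 'a::fd_hilbert" and ketY :: "'y \<Rightarrow> 'b::fd_hilbert"
  assumes X: "onb X ketX" and p: "p \<in> op_families X Y"
  shows "\<exists>!P. clinear P \<and> corresponds X ketX Y ketY P p"
proof (rule ex1I)
  \<comment> \<open>Expands \<open>a\<close> in the basis \<open>ketX\<close> and extends the
    prescribed values on basis vectors linearly.\<close>
  define g where "g h a = (\<Sum>x\<in>X. cinner (ketX x) a *\<^sub>C (\<Sum>y\<in>Y. ketY y \<otimes> p x y h))" for h a
  have lin: "clinear (p x y)" if "x \<in> X" "y \<in> Y" for x y
    using p that by (auto simp: op_families_def)
  have bilin: "bilin g"
    unfolding bilin_def
  proof (intro conjI allI clinearI)
    fix h a b c
    show "g h (a + b) = g h a + g h b" "g h (c *\<^sub>C a) = c *\<^sub>C g h a"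
      by (simp_all add: g_def cinner_add_right cinner_scaleC_right scaleC_add_left sum.distrib
          cv.scale_sum_right scaleC_scaleC)
  next
    fix h k a c
    show "g (h + k) a = g h a + g k a"
      by (simp add: g_def cvp.linear_add[OF lin] tens_add_right sum.distrib scaleC_add_right
          cong: sum.cong)
    show "g (c *\<^sub>C h) a = c *\<^sub>C g h a"
      by (simp add: g_def cvp.linear_scale[OF lin] tens_scaleC_right cv.scale_sum_right
          scaleC_scaleC mult.commute cong: sum.cong)
  qed
  have "g h (ketX x) = (\<Sum>y\<in>Y. ketY y \<otimes> p x y h)" if "x \<in> X" for h x
  proof -
    have "g h (ketX x) = (\<Sum>x'\<in>X. if x' = x then \<Sum>y\<in>Y. ketY y \<otimes> p x y h else 0)"
      unfolding g_def
      by (rule sum.cong) (use X that in \<open>auto simp: onb_def scaleC_one\<close>)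
    then show ?thesis using X that by (simp add: onb_def)
  qed
  then show g: "clinear (tlift g) \<and> corresponds X ketX Y ketY (tlift g) p"
    by (simp add: corresponds_def bilin clinear_tlift)
  fix Q
  assume Q: "clinear Q \<and> corresponds X ketX Y ketY Q p"
  show "Q = tlift g"
    using Q g by (intro tens_onb_ext_right[OF X]) (simp_all add: corresponds_def)
qed


section \<open>The axioms in terms of the operator family\<close>

context
  fixes X :: "'x set" and ketX :: "'x \<Rightarrow> 'a::fd_hilbert"
    and Y :: "'y set" and ketY :: "'y \<Rightarrow> 'b::fd_hilbert"
    and P :: "'h::fd_hilbert \<otimes> 'a \<Rightarrow> 'b \<otimes> 'h" and p :: "'x \<Rightarrow> 'y \<Rightarrow> 'h \<Rightarrow> 'h"
  assumes X: "onb X ketX" and Y: "onb Y ketY" and P: "clinear P"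
    and p: "p \<in> op_families X Y" and corr: "corresponds X ketX Y ketY P p"
begin

lemma finite_X: "finite X" and finite_Y: "finite Y"
  using X Y by (simp_all add: onb_def)

lemma clinear_p: "x \<in> X \<Longrightarrow> y \<in> Y \<Longrightarrow> clinear (p x y)"
  using p by (auto simp: op_families_def)

lemmas P_ket = correspondsD[OF corr]
lemmas P_sum = cvp.linear_sum[OF P]

text \<open>Rewrites a composite of structural maps applied to a simple tensor. The linearity facts
  are included to discharge the premises of \<open>tmap_tens\<close> and
  \<open>tmap_sum\<close>.\<close>

lemmas eval_simps = P_ket tmap_tens tmap_sum clinear_intros P assoc_tens assoc'_tens assoc_sum
  assoc'_sum lunit_tens runit_tens lunit_sum runit_sum tens_sum_left tens_sum_right scaleC_one
  runit'_def lunit'_def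

lemma comult_iff:
  "(dagger (set_mult Y ketY) \<otimes>\<^sub>l id) \<circ> P
        = assoc' \<circ> (id \<otimes>\<^sub>l P) \<circ> assoc \<circ> (P \<otimes>\<^sub>l id) \<circ> assoc' \<circ> (id \<otimes>\<^sub>l dagger (set_mult X ketX))
    \<longleftrightarrow> (\<forall>x\<in>X. \<forall>y1\<in>Y. \<forall>y2\<in>Y. p x y1 \<circ> p x y2 = (if y1 = y2 then p x y1 else (\<lambda>_. 0)))"
    (is "?L = ?R \<longleftrightarrow> ?rhs")
proof -
  have lin: "clinear ?L" "clinear ?R" by (intro clinear_intros P)+
  have "?L = ?R \<longleftrightarrow> (\<forall>x\<in>X. \<forall>h. ?L (h \<otimes> ketX x) = ?R (h \<otimes> ketX x))"
    by (rule tens_onb_eq_iff_right[OF X lin])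
  \<comment> \<open>On the right, the first use of \<open>P\<close> produces the index
    \<open>y\<close> and the second \<open>y'\<close>, so \<open>p x y'\<close> is applied after
    \<open>p x y\<close>. The reversed order is harmless, since both indices range over
    \<open>Y\<close> and the delta is symmetric.\<close>
  also have "\<dots> \<longleftrightarrow> (\<forall>x\<in>X. \<forall>h.
      (\<Sum>y\<in>Y. \<Sum>y'\<in>Y. (ketY y \<otimes> ketY y') \<otimes> (if y = y' then p x y h else 0))
      = (\<Sum>y\<in>Y. \<Sum>y'\<in>Y. (ketY y \<otimes> ketY y') \<otimes> p x y' (p x y h)))"
    unfolding sum_tens_diag[OF finite_Y]
    by (simp add: eval_simps dagger_set_mult_ket[OF X] dagger_set_mult_ket[OF Y])
  also have "\<dots> \<longleftrightarrow> (\<forall>x\<in>X. \<forall>h. \<forall>y\<in>Y. \<forall>y'\<in>Y. (if y = y' then p x y h else 0) = p x y' (p x y h))"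
    by (simp only: sum_tens_eq_iff2[OF Y])
  also have "\<dots> \<longleftrightarrow> ?rhs"
    by (auto simp: fun_eq_iff split: if_splits)
  finally show ?thesis .
qed

lemma counit_iff:
  "lunit \<circ> (dagger (set_unit Y ketY) \<otimes>\<^sub>l id) \<circ> P = runit \<circ> (id \<otimes>\<^sub>l dagger (set_unit X ketX))
    \<longleftrightarrow> (\<forall>x\<in>X. (\<lambda>h. \<Sum>y\<in>Y. p x y h) = id)"
    (is "?L = ?R \<longleftrightarrow> ?rhs")
proof -
  have lin: "clinear ?L" "clinear ?R" by (intro clinear_intros P)+
  have "?L = ?R \<longleftrightarrow> (\<forall>x\<in>X. \<forall>h. ?L (h \<otimes> ketX x) = ?R (h \<otimes> ketX x))"
    by (rule tens_onb_eq_iff_right[OF X lin])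
  also have "\<dots> \<longleftrightarrow> ?rhs"
    by (simp add: eval_simps dagger_set_unit_ket[OF X] dagger_set_unit_ket[OF Y] fun_eq_iff)
  finally show ?thesis .
qed

text \<open>The adjoint of a block matrix is its transpose with adjoint entries; this is verified by
  pairing with \<open>k \<otimes> ketX x\<close>.\<close>

lemma dagger_P_ket:
  assumes y: "y \<in> Y"
  shows "dagger P (ketY y \<otimes> h) = (\<Sum>x\<in>X. dagger (p x y) h \<otimes> ketX x)"
proof -
  have "cinner (dagger P (ketY y \<otimes> h)) = cinner (\<Sum>x\<in>X. dagger (p x y) h \<otimes> ketX x)"
  proof (rule tens_onb_ext_right[OF X clinear_cinner clinear_cinner])
    fix k x
    assume x: "x \<in> X"
    have "cinner (dagger P (ketY y \<otimes> h)) (k \<otimes> ketX x) = cinner (ketY y \<otimes> h) (P (k \<otimes> ketX x))"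
      by (rule cinner_dagger_left[OF P])
    also have "\<dots> = (\<Sum>y'\<in>Y. if y' = y then cinner h (p x y k) else 0)"
      unfolding P_ket[OF x] cinner_sum_right
      by (rule sum.cong) (use Y y in \<open>auto simp: cinner_tens onb_def\<close>)
    also have "\<dots> = cinner (dagger (p x y) h) k"
      using y finite_Y by (simp add: cinner_dagger_left[OF clinear_p[OF x y]])
    \<comment> \<open>Reintroduces a sum over \<open>X\<close> to match the expansion of the other
      functional termwise.\<close>
    also have "\<dots> = (\<Sum>x'\<in>X. if x' = x then cinner (dagger (p x y) h) k else 0)"
      using x finite_X by simp
    also have "\<dots> = cinner (\<Sum>x\<in>X. dagger (p x y) h \<otimes> ketX x) (k \<otimes> ketX x)"
      unfolding cinner_sum_left
      by (rule sum.cong) (use X x in \<open>auto simp: cinner_tens onb_def\<close>)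
    finally show "cinner (dagger P (ketY y \<otimes> h)) (k \<otimes> ketX x)
      = cinner (\<Sum>x\<in>X. dagger (p x y) h \<otimes> ketX x) (k \<otimes> ketX x)" .
  qed
  then show ?thesis by (simp only: cinner_inject)
qed

lemma pairing_ket:
  assumes "y \<in> Y" "y' \<in> Y"
  shows "dagger (set_unit Y ketY) (set_mult Y ketY (ketY y \<otimes> ketY y')) = (if y = y' then 1 else 0)"
  using assms
  by (simp add: set_mult_ket[OF Y] dagger_set_unit_ket[OF Y]
      cvp.linear_0[OF clinear_dagger[OF clinear_set_unit]])

lemma dagger_iff:
  "dagger P
        = lunit \<circ> ((dagger (set_unit Y ketY) \<circ> set_mult Y ketY) \<otimes>\<^sub>l (id \<otimes>\<^sub>l id)) \<circ> assoc
          \<circ> (assoc' \<otimes>\<^sub>l id) \<circ> ((id \<otimes>\<^sub>l P) \<otimes>\<^sub>l id) \<circ> (assoc \<otimes>\<^sub>l id) \<circ> assoc'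
          \<circ> ((id \<otimes>\<^sub>l id) \<otimes>\<^sub>l (dagger (set_mult X ketX) \<circ> set_unit X ketX)) \<circ> runit'
    \<longleftrightarrow> (\<forall>x\<in>X. \<forall>y\<in>Y. dagger (p x y) = p x y)"
    (is "?L = ?R \<longleftrightarrow> ?rhs")
proof -
  have lin: "clinear ?L" "clinear ?R" by (intro clinear_intros P)+
  \<comment> \<open>Unit and comultiplication insert \<open>ketX x \<otimes> ketX x\<close> summed
    over \<open>X\<close>. \<open>P\<close> consumes the first copy, the pairing on \<open>Y\<close>
    keeps the output that matches \<open>ketY y\<close>, and the second copy remains on the
    right.\<close>
  have R: "?R (ketY y \<otimes> h) = (\<Sum>x\<in>X. p x y h \<otimes> ketX x)" if y: "y \<in> Y" for y h
  proof -
    have cap: "(\<Sum>y'\<in>Y. (if y = y' then 1 else 0) *\<^sub>C (p x y' h \<otimes> ketX x)) = p x y h \<otimes> ketX x" for x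
    proof -
      have "(\<Sum>y'\<in>Y. (if y = y' then 1 else 0) *\<^sub>C (p x y' h \<otimes> ketX x))
          = (\<Sum>y'\<in>Y. if y = y' then p x y h \<otimes> ketX x else 0)"
        by (rule sum.cong) (auto simp: scaleC_one)
      then show ?thesis using y finite_Y by simp
    qed
    show ?thesis
      using y
      by (simp add: eval_simps set_unit_one cvp.linear_sum[OF clinear_dagger[OF clinear_set_mult]]
          dagger_set_mult_ket[OF X] pairing_ket cap cong: sum.cong)
  qed
  have "?L = ?R \<longleftrightarrow> (\<forall>y\<in>Y. \<forall>h. ?L (ketY y \<otimes> h) = ?R (ketY y \<otimes> h))"
    by (rule tens_onb_eq_iff_left[OF Y lin])
  also have "\<dots> \<longleftrightarrow> (\<forall>y\<in>Y. \<forall>h. (\<Sum>x\<in>X. dagger (p x y) h \<otimes> ketX x) = (\<Sum>x\<in>X. p x y h \<otimes> ketX x))"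
    by (simp only: R dagger_P_ket cong: ball_cong)
  also have "\<dots> \<longleftrightarrow> ?rhs"
    by (auto simp: sum_tens_right_eq_iff[OF X] fun_eq_iff)
  finally show ?thesis .
qed

lemma mult_iff:
  "P \<circ> (id \<otimes>\<^sub>l set_mult X ketX)
        = (set_mult Y ketY \<otimes>\<^sub>l id) \<circ> assoc' \<circ> (id \<otimes>\<^sub>l P) \<circ> assoc \<circ> (P \<otimes>\<^sub>l id) \<circ> assoc'
    \<longleftrightarrow> (\<forall>x1\<in>X. \<forall>x2\<in>X. \<forall>y\<in>Y. p x1 y \<circ> p x2 y = (if x1 = x2 then p x1 y else (\<lambda>_. 0)))"
    (is "?L = ?R \<longleftrightarrow> ?rhs")
proof -
  have lin: "clinear ?L" "clinear ?R" by (intro clinear_intros P)+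
  have L: "?L (h \<otimes> (ketX x \<otimes> ketX x')) = (\<Sum>y\<in>Y. ketY y \<otimes> (if x = x' then p x y h else 0))"
    if "x \<in> X" "x' \<in> X" for x x' h
    using that by (simp add: eval_simps set_mult_ket[OF X] cvp.linear_0[OF P])
  \<comment> \<open>\<open>ketX x\<close> passes through \<open>P\<close> before
    \<open>ketX x'\<close>, and the multiplication of \<open>Y\<close> forces both outputs to be the
    same \<open>y\<close>; hence \<open>p x' y\<close> is applied after
    \<open>p x y\<close>.\<close>
  have R: "?R (h \<otimes> (ketX x \<otimes> ketX x')) = (\<Sum>y\<in>Y. ketY y \<otimes> p x' y (p x y h))"
    if x: "x \<in> X" "x' \<in> X" for x x' h
  proof -
    have "?R (h \<otimes> (ketX x \<otimes> ketX x'))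
        = (\<Sum>y\<in>Y. \<Sum>y'\<in>Y. (if y = y' then ketY y else 0) \<otimes> p x' y' (p x y h))"
      using x by (simp add: eval_simps set_mult_ket[OF Y] cong: sum.cong)
    also have "\<dots> = (\<Sum>y\<in>Y. \<Sum>y'\<in>Y. if y = y' then ketY y \<otimes> p x' y (p x y h) else 0)"
      by (intro sum.cong) auto
    finally show ?thesis using finite_Y by simp
  qed
  have "?L = ?R \<longleftrightarrow> (\<forall>x\<in>X. \<forall>x'\<in>X. \<forall>h. ?L (h \<otimes> (ketX x \<otimes> ketX x')) = ?R (h \<otimes> (ketX x \<otimes> ketX x')))"
    by (rule tens_onb_eq_iff_right2[OF X lin])
  also have "\<dots> \<longleftrightarrow> (\<forall>x\<in>X. \<forall>x'\<in>X. \<forall>h. \<forall>y\<in>Y. (if x = x' then p x y h else 0) = p x' y (p x y h))"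
    by (simp only: L R sum_tens_eq_iff[OF Y] cong: ball_cong)
  also have "\<dots> \<longleftrightarrow> ?rhs"
  proof -
    \<comment> \<open>Here \<open>x'\<close> plays the role of \<open>x1\<close> and
      \<open>x\<close> that of \<open>x2\<close>.\<close>
    have "(if x = x' then p x y h else 0) = p x' y (p x y h)
        \<longleftrightarrow> (p x' y \<circ> p x y) h = (if x' = x then p x' y else (\<lambda>_. 0)) h" for x x' y h
      by auto
    then show ?thesis unfolding fun_eq_iff by blast
  qed
  finally show ?thesis .
qed

lemma unit_iff:
  "P \<circ> (id \<otimes>\<^sub>l set_unit X ketX) \<circ> runit' = (set_unit Y ketY \<otimes>\<^sub>l id) \<circ> lunit'
    \<longleftrightarrow> (\<forall>y\<in>Y. (\<lambda>h. \<Sum>x\<in>X. p x y h) = id)"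
    (is "?L = ?R \<longleftrightarrow> ?rhs")
proof -
  \<comment> \<open>Both sides have domain \<open>'h\<close> and are compared pointwise. Exchanging
    the sums collects the terms of each \<open>ketY y\<close>, so that column sums appear.\<close>
  have L: "?L h = (\<Sum>y\<in>Y. ketY y \<otimes> (\<Sum>x\<in>X. p x y h))" for h
    by (simp add: eval_simps set_unit_one P_sum) (rule sum.swap)
  have R: "?R h = (\<Sum>y\<in>Y. ketY y \<otimes> h)" for h
    by (simp add: eval_simps set_unit_one)
  have "?L = ?R \<longleftrightarrow> (\<forall>h. \<forall>y\<in>Y. (\<Sum>x\<in>X. p x y h) = h)"
    unfolding fun_eq_iff L R by (simp only: sum_tens_eq_iff[OF Y])
  then show ?thesis by (auto simp: fun_eq_iff)
qed

lemma quantum_function_iff: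
  "quantum_function (set_mult X ketX) (set_unit X ketX) (set_mult Y ketY) (set_unit Y ketY) P
    \<longleftrightarrow> (\<forall>x\<in>X. \<forall>y\<in>Y. projector (p x y)) \<and> row_condition X Y p"
proof -
  \<comment> \<open>Idempotence of the entries is the case \<open>y1 = y2\<close> of row
    orthogonality. Their self-adjointness comes from the axiom on \<open>dagger P\<close>, their
    linearity from \<open>op_families\<close>.\<close>
  have "p x y \<circ> p x y = p x y"
    if "\<forall>x\<in>X. \<forall>y1\<in>Y. \<forall>y2\<in>Y. p x y1 \<circ> p x y2 = (if y1 = y2 then p x y1 else (\<lambda>_. 0))"
      "x \<in> X" "y \<in> Y" for x y
    using that(1)[rule_format, OF that(2,3,3)] by simp
  then show ?thesis
    unfolding quantum_function_def comult_iff counit_iff dagger_iff row_condition_def projector_def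
    using P clinear_p by blast
qed

lemma quantum_bijection_iff:
  "quantum_bijection (set_mult X ketX) (set_unit X ketX) (set_mult Y ketY) (set_unit Y ketY) P
    \<longleftrightarrow> (\<forall>x\<in>X. \<forall>y\<in>Y. projector (p x y)) \<and> row_condition X Y p \<and> column_condition X Y p"
  unfolding quantum_bijection_def quantum_function_iff mult_iff unit_iff column_condition_def
  by blast

end

text \<open>The first two conjuncts make \<open>corresponds\<close> a bijection between linear maps
  and operator families; the word "exactly" then becomes the two equivalences for corresponding
  pairs.\<close>

theorem theorem4p14:
  fixes X :: "'x set" and ketX :: "'x \<Rightarrow> 'a::fd_hilbert"
    and Y :: "'y set" and ketY :: "'y \<Rightarrow> 'b::fd_hilbert"
  assumes "onb X ketX" and "onb Y ketY"
  shows "(\<forall>P :: 'h::fd_hilbert \<otimes> 'a \<Rightarrow> 'b \<otimes> 'h. clinear P \<longrightarrow>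
            (\<exists>!p. p \<in> op_families X Y \<and> corresponds X ketX Y ketY P p))
    \<and> (\<forall>p :: 'x \<Rightarrow> 'y \<Rightarrow> 'h \<Rightarrow> 'h. p \<in> op_families X Y \<longrightarrow>
            (\<exists>!P. clinear P \<and> corresponds X ketX Y ketY P p))
    \<and> (\<forall>(P :: 'h \<otimes> 'a \<Rightarrow> 'b \<otimes> 'h) p.
          clinear P \<longrightarrow> p \<in> op_families X Y \<longrightarrow> corresponds X ketX Y ketY P p \<longrightarrow>
            (quantum_function (set_mult X ketX) (set_unit X ketX)
                (set_mult Y ketY) (set_unit Y ketY) P
              \<longleftrightarrow> (\<forall>x\<in>X. \<forall>y\<in>Y. projector (p x y)) \<and> row_condition X Y p)
          \<and> (quantum_bijection (set_mult X ketX) (set_unit X ketX)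
                (set_mult Y ketY) (set_unit Y ketY) P
              \<longleftrightarrow> (\<forall>x\<in>X. \<forall>y\<in>Y. projector (p x y)) \<and> row_condition X Y p
                  \<and> column_condition X Y p))"
proof (intro conjI[OF _ conjI] allI impI)
  fix P :: "'h \<otimes> 'a \<Rightarrow> 'b \<otimes> 'h"
  assume "clinear P"
  then show "\<exists>!p. p \<in> op_families X Y \<and> corresponds X ketX Y ketY P p"
    by (rule ex1_family[OF assms(2)])
next
  fix p :: "'x \<Rightarrow> 'y \<Rightarrow> 'h \<Rightarrow> 'h"
  assume "p \<in> op_families X Y"
  then show "\<exists>!P :: 'h \<otimes> 'a \<Rightarrow> 'b \<otimes> 'h. clinear P \<and> corresponds X ketX Y ketY P p"
    by (rule ex1_map[OF assms(1)])
qed (intro conjI quantum_function_iff[OF assms] quantum_bijection_iff[OF assms]; assumption)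

end
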